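(* Let $X$ be a finite set. An operation $\ast\in\mathcal{M}(X)$ is a regular element of $\mathcal{M}(X)$ if and only if $cim(T_\ast)=diag(T_\ast)$.
   Context: $\mathcal{M}(X)=X^{X\times X}$ is the set of all binary operations on $X$, a monoid under $\triangleright$ defined by $a(\circ\triangleright\ast)b=(a\circ b)\ast(b\circ a)$ for all $a,b\in X$. An element $\ast\in\mathcal{M}(X)$ is regular if there is $\circ\in\mathcal{M}(X)$ with $\ast\triangleright\circ\triangleright\ast=\ast$. The pairmorph transformation of $\ast$ is $T_\ast:X\times X\to X\times X$, $T_\ast(a,b)=(a\ast b,b\ast a)$. With $\Delta(X)=\{(x,x):x\in X\}$: $im(T_\ast)=T_\ast(X\times X)$, $diag(T_\ast)=T_\ast(\Delta(X))$, and $cim(T_\ast)=im(T_\ast)\cap\Delta(X)$. *)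

theory Defs
  imports "HOL-Library.FuncSet" "HOL-Algebra.Group"
begin

text \<open>A binary operation on the set \<open>X\<close> is a function on pairs that is undefined outside
  \<open>X \<times> X\<close>, so equality of two operations in the carrier is equality on \<open>X \<times> X\<close>.\<close>

definition binop_monoid :: "'a set \<Rightarrow> ('a \<times> 'a \<Rightarrow> 'a) monoid" where
  "binop_monoid X =
     \<lparr> carrier = X \<times> X \<rightarrow>\<^sub>E X,
       monoid.mult = (\<lambda>f g. \<lambda>(a, b)\<in>X \<times> X. g (f (a, b), f (b, a))),
       one = (\<lambda>(a, b)\<in>X \<times> X. a) \<rparr>"

lemma monoid_binop_monoid: "monoid (binop_monoid X)"
  by (rule monoidI)
    (auto simp: binop_monoid_def PiE_iff extensional_def restrict_def fun_eq_iff)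

definition regular_element :: "('m, 'b) monoid_scheme \<Rightarrow> 'm \<Rightarrow> bool" where
  "regular_element M f \<longleftrightarrow>
     f \<in> carrier M \<and> (\<exists>g\<in>carrier M. f \<otimes>\<^bsub>M\<^esub> g \<otimes>\<^bsub>M\<^esub> f = f)"

definition pairmorph :: "'a set \<Rightarrow> ('a \<times> 'a \<Rightarrow> 'a) \<Rightarrow> 'a \<times> 'a \<Rightarrow> 'a \<times> 'a" where
  "pairmorph X f = (\<lambda>(a, b)\<in>X \<times> X. (f (a, b), f (b, a)))"

definition pm_im :: "'a set \<Rightarrow> ('a \<times> 'a \<Rightarrow> 'a \<times> 'a) \<Rightarrow> ('a \<times> 'a) set" where
  "pm_im X T = T ` (X \<times> X)"

text \<open>The diagonal of \<open>X \<times> X\<close> is the library's \<^const>\<open>Id_on\<close> applied to \<open>X\<close>.\<close>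

definition pm_diag :: "'a set \<Rightarrow> ('a \<times> 'a \<Rightarrow> 'a \<times> 'a) \<Rightarrow> ('a \<times> 'a) set" where
  "pm_diag X T = T ` Id_on X"

definition pm_cim :: "'a set \<Rightarrow> ('a \<times> 'a \<Rightarrow> 'a \<times> 'a) \<Rightarrow> ('a \<times> 'a) set" where
  "pm_cim X T = pm_im X T \<inter> Id_on X"

end

theory Submission imports Defs begin

text \<open>The pairmorph transformations are exactly the self-maps of \<open>X \<times> X\<close> commuting with the
  swap \<open>(a, b) \<mapsto> (b, a)\<close>, and \<open>f \<mapsto> T\<^sub>f\<close> turns the product into composition.  So \<open>f\<close> is
  regular iff \<open>T\<^sub>f\<close> has a swap-equivariant quasi-inverse \<open>S\<close>.  The fixed points of the swap are
  the diagonal pairs, so \<open>S\<close> sends each diagonal pair in the image to a diagonal preimage, which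
  is the condition \<open>cim = diag\<close>.  Conversely, choose a diagonal preimage of each diagonal pair in
  the image; the remaining orbits of the swap are free, so it suffices to choose a preimage of one
  representative of each and extend by equivariance.\<close>

lemma binop_monoid_carrier: "carrier (binop_monoid X) = X \<times> X \<rightarrow>\<^sub>E X"
  by (simp add: binop_monoid_def)

lemma pairmorph_apply:
  "a \<in> X \<Longrightarrow> b \<in> X \<Longrightarrow> pairmorph X f (a, b) = (f (a, b), f (b, a))"
  by (simp add: pairmorph_def)

lemma pairmorph_funcset:
  "f \<in> X \<times> X \<rightarrow> X \<Longrightarrow> pairmorph X f \<in> X \<times> X \<rightarrow> X \<times> X"
  by (auto simp: pairmorph_def)

lemma pairmorph_swap:
  "p \<in> X \<times> X \<Longrightarrow> pairmorph X f (prod.swap p) = prod.swap (pairmorph X f p)"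
  by (auto simp: pairmorph_def)

lemma pairmorph_Id_on:
  "f \<in> X \<times> X \<rightarrow> X \<Longrightarrow> p \<in> Id_on X \<Longrightarrow> pairmorph X f p \<in> Id_on X"
  by (auto simp: pairmorph_def)

lemma pairmorph_mult:
  assumes "f \<in> X \<times> X \<rightarrow> X" and "p \<in> X \<times> X"
  shows "pairmorph X (f \<otimes>\<^bsub>binop_monoid X\<^esub> g) p = pairmorph X g (pairmorph X f p)"
  using assms by (auto simp: binop_monoid_def pairmorph_def Pi_iff)

text \<open>On \<open>X \<times> X\<close> the first component of \<open>pairmorph X f\<close> is
  \<open>f\<close> itself, and members of the carrier all take the value \<open>undefined\<close>
  elsewhere.\<close>

lemma pairmorph_eqI:
  assumes "f \<in> carrier (binop_monoid X)" and "g \<in> carrier (binop_monoid X)"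
    and "\<And>p. p \<in> X \<times> X \<Longrightarrow> pairmorph X f p = pairmorph X g p"
  shows "f = g"
proof (rule PiE_ext)
  show "f \<in> X \<times> X \<rightarrow>\<^sub>E X" "g \<in> X \<times> X \<rightarrow>\<^sub>E X"
    using assms by (simp_all add: binop_monoid_carrier)
  show "f p = g p" if "p \<in> X \<times> X" for p
    using assms(3)[OF that] that by (auto simp: pairmorph_def)
qed

lemma regular_element_iff_quasi_inverse:
  assumes f: "f \<in> carrier (binop_monoid X)"
  shows "regular_element (binop_monoid X) f \<longleftrightarrow>
    (\<exists>g\<in>carrier (binop_monoid X). \<forall>p\<in>X \<times> X.
      pairmorph X f (pairmorph X g (pairmorph X f p)) = pairmorph X f p)"
proof -
  interpret monoid "binop_monoid X" by (rule monoid_binop_monoid)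
  have "f \<otimes>\<^bsub>binop_monoid X\<^esub> g \<otimes>\<^bsub>binop_monoid X\<^esub> f = f \<longleftrightarrow>
      (\<forall>p\<in>X \<times> X. pairmorph X f (pairmorph X g (pairmorph X f p)) = pairmorph X f p)"
    if g: "g \<in> carrier (binop_monoid X)" for g
  proof -
    have fg: "f \<otimes>\<^bsub>binop_monoid X\<^esub> g \<in> carrier (binop_monoid X)"
      using f g by simp
    have T: "pairmorph X (f \<otimes>\<^bsub>binop_monoid X\<^esub> g \<otimes>\<^bsub>binop_monoid X\<^esub> f) p =
        pairmorph X f (pairmorph X g (pairmorph X f p))" if "p \<in> X \<times> X" for p
    proof -
      have "f \<in> X \<times> X \<rightarrow> X" "f \<otimes>\<^bsub>binop_monoid X\<^esub> g \<in> X \<times> X \<rightarrow> X"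
        using f fg by (auto simp: binop_monoid_carrier PiE_def)
      then show ?thesis using that by (simp add: pairmorph_mult del: mem_Sigma_iff)
    qed
    show ?thesis
      using pairmorph_eqI[OF m_closed[OF fg f] f] T by metis
  qed
  then show ?thesis using f by (auto simp: regular_element_def)
qed

text \<open>A swap-equivariant map sends diagonal pairs to diagonal pairs. As this inclusion always
  holds, the criterion comes down to the reverse one.\<close>

lemma pm_diag_subset_pm_cim:
  assumes "f \<in> X \<times> X \<rightarrow> X"
  shows "pm_diag X (pairmorph X f) \<subseteq> pm_cim X (pairmorph X f)"
  using pairmorph_Id_on[OF assms] Id_on_subset_Times[of X]
  unfolding pm_diag_def pm_cim_def pm_im_def by blast

lemma pm_cim_subset_if_quasi_inverse:
  assumes "g \<in> X \<times> X \<rightarrow> X"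
    and "\<And>p. p \<in> X \<times> X \<Longrightarrow>
      pairmorph X f (pairmorph X g (pairmorph X f p)) = pairmorph X f p"
  shows "pm_cim X (pairmorph X f) \<subseteq> pm_diag X (pairmorph X f)"
proof
  fix y assume "y \<in> pm_cim X (pairmorph X f)"
  then have y: "y \<in> pm_im X (pairmorph X f)" "y \<in> Id_on X"
    by (auto simp: pm_cim_def)
  \<comment> \<open>Write \<open>y\<close> as \<open>pairmorph X f p\<close> and apply the
    quasi-inverse equation at \<open>p\<close>.\<close>
  then have "y = pairmorph X f (pairmorph X g y)"
    using assms(2) unfolding pm_im_def by fastforce
  moreover have "pairmorph X g y \<in> Id_on X"
    using pairmorph_Id_on[OF assms(1) y(2)] .
  ultimately show "y \<in> pm_diag X (pairmorph X f)"
    unfolding pm_diag_def by (rule image_eqI)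
qed

text \<open>A pair and its swap span the same two-element set, so Hilbert choice from that set picks
  the same element for both; no order on \<open>'a\<close> is involved.\<close>

lemma swap_representative:
  obtains rep :: "'a \<times> 'a \<Rightarrow> 'a \<times> 'a"
  where "\<And>p. rep p = p \<or> rep p = prod.swap p" and "\<And>p. rep (prod.swap p) = rep p"
proof
  show "(SOME q. q \<in> {p, prod.swap p}) = p \<or> (SOME q. q \<in> {p, prod.swap p}) = prod.swap p"
    for p :: "'a \<times> 'a"
    using someI[of "\<lambda>q. q \<in> {p, prod.swap p}" p] by blast
  show "(SOME q. q \<in> {prod.swap p, prod.swap (prod.swap p)}) = (SOME q. q \<in> {p, prod.swap p})"
    for p :: "'a \<times> 'a"
    by (simp add: insert_commute disj_commute)
qed

lemma quasi_inverse_if_pm_cim_subset: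
  assumes f: "f \<in> X \<times> X \<rightarrow> X"
    and sub: "pm_cim X (pairmorph X f) \<subseteq> pm_diag X (pairmorph X f)"
  obtains g where "g \<in> carrier (binop_monoid X)"
    and "\<And>p. p \<in> X \<times> X \<Longrightarrow>
      pairmorph X f (pairmorph X g (pairmorph X f p)) = pairmorph X f p"
proof -
  let ?T = "pairmorph X f"
  \<comment> \<open>This yields a section \<open>z\<close> of \<open>?T\<close> that respects the
    diagonal but need not commute with the swap.\<close>
  have "\<forall>y\<in>pm_im X ?T. \<exists>p\<in>X \<times> X. ?T p = y \<and> (y \<in> Id_on X \<longrightarrow> p \<in> Id_on X)"
  proof
    fix y assume y: "y \<in> pm_im X ?T"
    show "\<exists>p\<in>X \<times> X. ?T p = y \<and> (y \<in> Id_on X \<longrightarrow> p \<in> Id_on X)"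
    proof (cases "y \<in> Id_on X")
      case True
      then have "y \<in> pm_diag X ?T" using y sub by (auto simp: pm_cim_def)
      then show ?thesis by (force simp: pm_diag_def)
    next
      case False
      then show ?thesis using y unfolding pm_im_def by blast
    qed
  qed
  then obtain z where z: "\<And>y. y \<in> pm_im X ?T \<Longrightarrow> z y \<in> X \<times> X"
      "\<And>y. y \<in> pm_im X ?T \<Longrightarrow> ?T (z y) = y"
      "\<And>y. y \<in> pm_im X ?T \<Longrightarrow> y \<in> Id_on X \<Longrightarrow> z y \<in> Id_on X"
    by metis
  obtain rep :: "'a \<times> 'a \<Rightarrow> 'a \<times> 'a"
    where rep: "\<And>p. rep p = p \<or> rep p = prod.swap p" "\<And>p. rep (prod.swap p) = rep p"
    using swap_representative by blast
  have swap_im: "prod.swap y \<in> pm_im X ?T" if y: "y \<in> pm_im X ?T" for y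
  proof -
    obtain p where p: "p \<in> X \<times> X" "y = ?T p" using y by (auto simp: pm_im_def)
    then have "prod.swap y = ?T (prod.swap p)" by (simp only: pairmorph_swap)
    moreover have "prod.swap p \<in> X \<times> X" using p by auto
    ultimately show ?thesis unfolding pm_im_def by (rule image_eqI)
  qed
  \<comment> \<open>\<open>g\<close> is the first component of the equivariant correction of
    \<open>z\<close>: \<open>z y\<close> at a representative \<open>y\<close>, and the swap of
    \<open>z (prod.swap y)\<close> otherwise. The value \<open>fst y\<close> off the image only
    keeps \<open>g\<close> inside \<open>X\<close>.\<close>
  define g where "g = (\<lambda>y\<in>X \<times> X. if y \<in> pm_im X ?T
    then if rep y = y then fst (z y) else snd (z (prod.swap y)) else fst y)"
  have im_sub: "y \<in> X \<times> X" if "y \<in> pm_im X ?T" for y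
    using that pairmorph_funcset[OF f] unfolding pm_im_def by blast
  have "g y \<in> X" if "y \<in> X \<times> X" for y
    using that z(1)[of y] z(1)[of "prod.swap y"] swap_im[of y]
    by (auto simp: g_def mem_Times_iff)
  then have g: "g \<in> carrier (binop_monoid X)"
    unfolding binop_monoid_carrier by (auto simp: g_def)
  have inv: "?T (pairmorph X g y) = y" if y: "y \<in> pm_im X ?T" for y
  proof -
    obtain a b where ab: "y = (a, b)" by (cases y)
    have X: "a \<in> X" "b \<in> X" using im_sub[OF y] ab by auto
    have sy: "(b, a) \<in> pm_im X ?T" using swap_im[OF y] ab by simp
    have S: "pairmorph X g y = (g (a, b), g (b, a))" using X ab by (simp add: pairmorph_apply)
    consider (diagonal) "a = b" | (representative) "a \<noteq> b" "rep (a, b) = (a, b)"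
      | (swapped) "a \<noteq> b" "rep (a, b) = (b, a)"
      using rep(1)[of "(a, b)"] by auto
    then show ?thesis
    proof cases
      case diagonal
      \<comment> \<open>Both components of \<open>pairmorph X g y\<close> equal
        \<open>fst (z y)\<close>, so \<open>z y\<close> has to be diagonal.\<close>
      then have "z y \<in> Id_on X" using z(3)[OF y] X ab by auto
      moreover have "rep y = y" using rep(1)[of y] diagonal ab by auto
      ultimately have "pairmorph X g y = z y"
        using S diagonal X y ab by (auto simp: g_def)
      then show ?thesis using z(2)[OF y] by simp
    next
      case representative
      \<comment> \<open>Hence \<open>g (b, a)\<close> falls into the second branch and returns
        \<open>snd (z y)\<close>.\<close>
      then have "rep (b, a) \<noteq> (b, a)" using rep(2)[of "(a, b)"] by simp
      then have "pairmorph X g y = z y"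
        using S representative X y sy ab by (auto simp: g_def)
      then show ?thesis using z(2)[OF y] by simp
    next
      case swapped
      then have "rep (b, a) = (b, a)" using rep(2)[of "(a, b)"] by simp
      then have "pairmorph X g y = prod.swap (z (b, a))"
        using S swapped X y sy ab by (auto simp: g_def prod.swap_def)
      \<comment> \<open>Equivariance of \<open>?T\<close> moves the swap outside, leaving the swap
        of \<open>(b, a)\<close>, which is \<open>y\<close>.\<close>
      then show ?thesis using z(1,2)[OF sy] ab by (simp add: pairmorph_swap del: mem_Sigma_iff)
    qed
  qed
  show thesis
    by (rule that[OF g]) (auto intro!: inv simp: pm_im_def)
qed

theorem proposition24:
  fixes X :: "'a set" and f :: "'a \<times> 'a \<Rightarrow> 'a"
  assumes "finite X" and "f \<in> carrier (binop_monoid X)"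
  shows "regular_element (binop_monoid X) f \<longleftrightarrow>
         pm_cim X (pairmorph X f) = pm_diag X (pairmorph X f)"
proof -
  have f: "f \<in> X \<times> X \<rightarrow> X" using assms(2) by (auto simp: binop_monoid_carrier PiE_def)
  have "regular_element (binop_monoid X) f \<longleftrightarrow>
      pm_cim X (pairmorph X f) \<subseteq> pm_diag X (pairmorph X f)"
  proof
    assume "regular_element (binop_monoid X) f"
    then obtain g where "g \<in> carrier (binop_monoid X)"
      and "\<forall>p\<in>X \<times> X. pairmorph X f (pairmorph X g (pairmorph X f p)) = pairmorph X f p"
      using regular_element_iff_quasi_inverse[OF assms(2)] by blast
    then show "pm_cim X (pairmorph X f) \<subseteq> pm_diag X (pairmorph X f)"
      by (intro pm_cim_subset_if_quasi_inverse[of g])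
        (auto simp: binop_monoid_carrier PiE_def)
  next
    assume "pm_cim X (pairmorph X f) \<subseteq> pm_diag X (pairmorph X f)"
    then show "regular_element (binop_monoid X) f"
      using quasi_inverse_if_pm_cim_subset[OF f] regular_element_iff_quasi_inverse[OF assms(2)]
      by metis
  qed
  then show ?thesis using pm_diag_subset_pm_cim[OF f] by blast
qed

end
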